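(* Let $\mathcal{T}_\alpha$ be a weighted magnetic triangulation with weights $c,r,s$, endowed with an origin vertex $\mathcal{O}\in\mathcal{V}$. Assume that, as $n\to\infty$, $$\sup_{x\in\mathcal{B}_n}deg_{\mathcal{V}}(x)=O(n^2)\quad\text{and}\quad\sup_{(x,y)\in\mathcal{E}\cap(\mathcal{B}_n\times\mathcal{B}_{n\pm1})}deg_{\mathcal{E}}(x,y)=O(n^2).$$ Then $\mathcal{T}_\alpha$ is $\chi$-complete.
   Context: Magnetic triangulation. A graph $(\mathcal{V},\mathcal{E})$ consists of an at most countable set $\mathcal{V}$ and a symmetric set $\mathcal{E}\subset\mathcal{V}\times\mathcal{V}$ of (oriented) edges without loops; it is assumed connected and locally finite. For $e=(x,y)\in\mathcal{E}$ put $e^-=x$, $e^+=y$; $x\sim y$ means $(x,y)\in\mathcal{E}$. A magnetic potential is a function $\alpha:\mathcal{E}\to\mathbb{R}$ with $\alpha(x,y)=-\alpha(y,x)$. A symmetric set of triangular faces is a set $\mathcal{F}\subset\mathcal{V}^3$, stable under all permutations of the three entries, such that $(x,y,z)\in\mathcal{F}$ implies that $x,y,z$ are pairwise adjacent (not every 3-cycle needs to be a face). $\mathcal{T}_\alpha=((\mathcal{V},\mathcal{E},\alpha),\mathcal{F})$ is a magnetic triangulation. For an edge $(x,y)$ put $\mathcal{F}_{xy}=\{z\in\mathcal{V}:(x,y,z)\in\mathcal{F}\}$. Weights: $c:\mathcal{V}\to(0,\infty)$; $r:\mathcal{E}\to(0,\infty)$ symmetric; $s:\mathcal{F}\to(0,\infty)$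 invariant under all permutations. Weighted degrees: $deg_{\mathcal{V}}(x)=\frac1{c(x)}\sum_{y\sim x}r(x,y)$ for $x\in\mathcal{V}$, and $deg_{\mathcal{E}}(x,y)=\frac1{r(x,y)}\sum_{z\in\mathcal{F}_{xy}}s(x,y,z)$ for $(x,y)\in\mathcal{E}$. Balls: $|x|$ is the combinatorial distance from $\mathcal{O}$ to $x$ (minimal number of edges of a path from $\mathcal{O}$ to $x$), and $\mathcal{B}_n=\{x\in\mathcal{V}:|x|\le n\}$. $\chi$-completeness: let $d^0f(x,y)=f(y)-f(x)$. The weighted triangulation is $\chi$-complete if there are a constant $C>0$, an increasing sequence of finite sets $(B_n)_{n\in\mathbb{N}}$ with $\mathcal{V}=\bigcup_nB_n$, and finitely supported functions $\chi_n:\mathcal{V}\to\mathbb{R}$ with $0\le\chi_n\le1$ and $\chi_n=1$ on $B_n$, such that for all $n$: for all $x\in\mathcal{V}$, $\frac1{c(x)}\sum_{e\in\mathcal{E},\,e^+=x}r(e)|d^0\chi_n(e)|^2\le C$; and for all $(x,y)\in\mathcal{E}$, $\frac1{r(x,y)}\sum_{t\in\mathcal{F}_{xy}}s(x,y,t)\,|d^0\chi_n(t,x)+d^0\chi_n(t,y)|^2\le C$. *)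

theory Defs
  imports Complex_Main "HOL-Library.Countable_Set" "HOL-Library.Landau_Symbols"
begin

text \<open>
  Potentials and weights are total functions; only their values on \<open>V\<close>, \<open>E\<close> and \<open>F\<close>
  are constrained, and only those values are ever used.
\<close>

locale lf_connected_graph =
  fixes V :: "'v set" and E :: "('v \<times> 'v) set"
  assumes countable_V: "countable V"
    and E_subset: "E \<subseteq> V \<times> V"
    and sym_E: "sym E"
    and irrefl_E: "irrefl E"
    and connected: "x \<in> V \<Longrightarrow> y \<in> V \<Longrightarrow> (x, y) \<in> E\<^sup>*"
    and locally_finite: "x \<in> V \<Longrightarrow> finite {y. (x, y) \<in> E}"

locale magnetic_graph = lf_connected_graph V E
  for V :: "'v set" and E :: "('v \<times> 'v) set" +
  fixes \<alpha> :: "'v \<times> 'v \<Rightarrow> real"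
  assumes antisym_\<alpha>: "(x, y) \<in> E \<Longrightarrow> \<alpha> (x, y) = - \<alpha> (y, x)"

locale magnetic_triangulation = magnetic_graph V E \<alpha>
  for V :: "'v set" and E :: "('v \<times> 'v) set" and \<alpha> :: "'v \<times> 'v \<Rightarrow> real" +
  fixes F :: "('v \<times> 'v \<times> 'v) set"
  assumes perm_F: "(x, y, z) \<in> F \<Longrightarrow>
      (x, z, y) \<in> F \<and> (y, x, z) \<in> F \<and> (y, z, x) \<in> F \<and> (z, x, y) \<in> F \<and> (z, y, x) \<in> F"
    and adjacent_F: "(x, y, z) \<in> F \<Longrightarrow> (x, y) \<in> E \<and> (y, z) \<in> E \<and> (z, x) \<in> E"

locale weighted_magnetic_triangulation = magnetic_triangulation V E \<alpha> F
  for V :: "'v set" and E :: "('v \<times> 'v) set" and \<alpha> :: "'v \<times> 'v \<Rightarrow> real"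
    and F :: "('v \<times> 'v \<times> 'v) set" +
  fixes c :: "'v \<Rightarrow> real" and r :: "'v \<times> 'v \<Rightarrow> real" and s :: "'v \<times> 'v \<times> 'v \<Rightarrow> real"
  assumes c_pos: "x \<in> V \<Longrightarrow> c x > 0"
    and r_pos: "e \<in> E \<Longrightarrow> r e > 0"
    and r_sym: "(x, y) \<in> E \<Longrightarrow> r (y, x) = r (x, y)"
    and s_pos: "t \<in> F \<Longrightarrow> s t > 0"
    and s_perm: "(x, y, z) \<in> F \<Longrightarrow>
      s (x, z, y) = s (x, y, z) \<and> s (y, x, z) = s (x, y, z) \<and> s (y, z, x) = s (x, y, z) \<and>
      s (z, x, y) = s (x, y, z) \<and> s (z, y, x) = s (x, y, z)"

definition faces_at :: "'v set \<Rightarrow> ('v \<times> 'v \<times> 'v) set \<Rightarrow> 'v \<Rightarrow> 'v \<Rightarrow> 'v set" where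
  "faces_at V F x y = {z \<in> V. (x, y, z) \<in> F}"

definition deg_V :: "('v \<times> 'v) set \<Rightarrow> ('v \<Rightarrow> real) \<Rightarrow> ('v \<times> 'v \<Rightarrow> real) \<Rightarrow> 'v \<Rightarrow> real" where
  "deg_V E c r x = (1 / c x) * (\<Sum>y\<in>{y. (x, y) \<in> E}. r (x, y))"

definition deg_E :: "'v set \<Rightarrow> ('v \<times> 'v \<times> 'v) set \<Rightarrow> ('v \<times> 'v \<Rightarrow> real) \<Rightarrow>
    ('v \<times> 'v \<times> 'v \<Rightarrow> real) \<Rightarrow> 'v \<Rightarrow> 'v \<Rightarrow> real" where
  "deg_E V F r s x y = (1 / r (x, y)) * (\<Sum>z\<in>faces_at V F x y. s (x, y, z))"

text \<open>\<open>E ^^ n\<close> relates the endpoints of walks with exactly \<open>n\<close> edges.\<close>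

definition comb_dist :: "('v \<times> 'v) set \<Rightarrow> 'v \<Rightarrow> 'v \<Rightarrow> nat" where
  "comb_dist E x y = (LEAST n. (x, y) \<in> E ^^ n)"

definition comb_ball :: "'v set \<Rightarrow> ('v \<times> 'v) set \<Rightarrow> 'v \<Rightarrow> nat \<Rightarrow> 'v set" where
  "comb_ball V E x0 n = {x \<in> V. comb_dist E x0 x \<le> n}"

text \<open>
  The edges in \<open>B\<^sub>n \<times> B\<^sub>n\<^sub>\<plusminus>\<^sub>1\<close>, with both signs allowed. For \<open>n = 0\<close> the truncated
  subtraction is harmless, because \<open>B\<^sub>0 \<subseteq> B\<^sub>1\<close>.
\<close>

definition ball_edges :: "'v set \<Rightarrow> ('v \<times> 'v) set \<Rightarrow> 'v \<Rightarrow> nat \<Rightarrow> ('v \<times> 'v) set" where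
  "ball_edges V E x0 n =
     E \<inter> (comb_ball V E x0 n \<times> (comb_ball V E x0 (n + 1) \<union> comb_ball V E x0 (n - 1)))"

definition d0 :: "('v \<Rightarrow> real) \<Rightarrow> 'v \<times> 'v \<Rightarrow> real" where
  "d0 f e = f (snd e) - f (fst e)"

definition chi_complete :: "'v set \<Rightarrow> ('v \<times> 'v) set \<Rightarrow> ('v \<times> 'v \<times> 'v) set \<Rightarrow>
    ('v \<Rightarrow> real) \<Rightarrow> ('v \<times> 'v \<Rightarrow> real) \<Rightarrow> ('v \<times> 'v \<times> 'v \<Rightarrow> real) \<Rightarrow> bool" where
  "chi_complete V E F c r s \<longleftrightarrow>
     (\<exists>(C :: real) (B :: nat \<Rightarrow> 'v set) (\<chi> :: nat \<Rightarrow> 'v \<Rightarrow> real).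
        C > 0 \<and>
        incseq B \<and> (\<forall>n. finite (B n)) \<and> V = (\<Union>n. B n) \<and>
        (\<forall>n. finite {x \<in> V. \<chi> n x \<noteq> 0} \<and>
             (\<forall>x\<in>V. 0 \<le> \<chi> n x \<and> \<chi> n x \<le> 1) \<and>
             (\<forall>x\<in>B n. \<chi> n x = 1) \<and>
             (\<forall>x\<in>V. (1 / c x) * (\<Sum>e\<in>{e \<in> E. snd e = x}. r e * \<bar>d0 (\<chi> n) e\<bar>\<^sup>2) \<le> C) \<and>
             (\<forall>(x, y)\<in>E. (1 / r (x, y)) *
                (\<Sum>t\<in>faces_at V F x y.
                   s (x, y, t) * \<bar>d0 (\<chi> n) (t, x) + d0 (\<chi> n) (t, y)\<bar>\<^sup>2) \<le> C)))"

text \<open>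
  Balls around a vertex are finite by local finiteness, so real suprema over \<open>comb_ball\<close> and
  \<open>ball_edges\<close> are maxima. The only exception is \<open>E = {}\<close> (a one-vertex graph), where the
  supremum over edges does not depend on \<open>n\<close>, and its growth condition holds trivially.
\<close>

end

theory Submission imports Defs begin

text \<open>
  With \<open>m = n + 1\<close> take the cutoff equal to \<open>1\<close> on the ball of radius \<open>m\<close>, decreasing linearly in
  the distance to the origin, and vanishing from radius \<open>2 m\<close> on. Across an edge it varies by at
  most \<open>1 / m\<close>, and at a vertex outside the ball of radius \<open>2 m\<close> it is zero together with all its
  neighbours. So both energy sums either vanish or are bounded by a degree in the ball of radius
  \<open>2 m\<close> times a constant over \<open>m\<^sup>2\<close>, and the growth hypothesis bounds the product.
\<close>

text \<open>The O-condition only speaks about large indices. For smaller \<open>n\<close>,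
  monotonicity of \<open>S\<close> moves \<open>x\<close> into \<open>S N\<close>, and
  \<open>n \<ge> 1\<close> lets a factor \<open>N^2\<close> absorb the loss. Finiteness makes each
  \<open>SUP\<close> a genuine upper bound.\<close>

lemma bigo_SUP_imp_bound:
  fixes f :: "'a \<Rightarrow> real" and S :: "nat \<Rightarrow> 'a set"
  assumes "incseq S" and fin: "\<And>n. finite (S n)"
    and O: "(\<lambda>n. SUP x\<in>S n. f x) \<in> O(\<lambda>n. real n ^ 2)"
  obtains K where "K > 0" "\<And>n x. n \<ge> 1 \<Longrightarrow> x \<in> S n \<Longrightarrow> f x \<le> K * real n ^ 2"
proof -
  from O obtain A where A: "A > 0"
    and ev: "eventually (\<lambda>n. norm (SUP x\<in>S n. f x) \<le> A * norm (real n ^ 2)) sequentially"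
    by (elim landau_o.bigE)
  from ev obtain N0 where N0: "\<And>n. n \<ge> N0 \<Longrightarrow> \<bar>SUP x\<in>S n. f x\<bar> \<le> A * real n ^ 2"
    by (auto simp: eventually_sequentially)
  define N where "N = Suc N0"
  have large: "f x \<le> A * real n ^ 2" if "n \<ge> N" "x \<in> S n" for n x
  proof -
    have "f x \<le> (SUP x\<in>S n. f x)"
      using that fin by (intro cSUP_upper bdd_above_finite) auto
    then show ?thesis using N0[of n] that unfolding N_def by linarith
  qed
  show thesis
  proof
    show "A * real N ^ 2 > 0" using A by (simp add: N_def)
    fix n x assume n: "n \<ge> 1" "x \<in> S n"
    \<comment> \<open>Both factors are at least 1, so the product dominates each of them.\<close>
    have "max n N \<le> N * n"
      using n by (cases n) (auto simp: N_def)
    then have max_le: "real (max n N) \<le> real N * real n"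
      by (simp only: of_nat_le_iff flip: of_nat_mult)
    have "f x \<le> A * real (max n N) ^ 2"
      using large[of "max n N" x] n incseqD[OF \<open>incseq S\<close>, of n "max n N"] by auto
    also have "A * real (max n N) ^ 2 \<le> A * (real N * real n) ^ 2"
      using A max_le by (intro mult_left_mono power_mono) auto
    finally show "f x \<le> A * real N ^ 2 * real n ^ 2" by (simp add: power_mult_distrib)
  qed
qed

context lf_connected_graph
begin

lemma relpow_comb_dist:
  assumes "x \<in> V" "y \<in> V"
  shows "(x, y) \<in> E ^^ comb_dist E x y"
  using connected[OF assms] unfolding comb_dist_def rtrancl_power by (rule LeastI_ex)

lemma comb_dist_edge:
  assumes "x0 \<in> V" "(x, y) \<in> E"
  shows "comb_dist E x0 y \<le> Suc (comb_dist E x0 x)"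
proof -
  have "(x0, y) \<in> E ^^ Suc (comb_dist E x0 x)"
    using relpow_comb_dist[OF \<open>x0 \<in> V\<close>, of x] assms E_subset by auto
  then show ?thesis unfolding comb_dist_def[of E x0 y] by (rule Least_le)
qed

lemma finite_relpow_sphere:
  assumes "x0 \<in> V"
  shows "finite {x. (x0, x) \<in> E ^^ n}"
proof (induction n)
  case (Suc n)
  have "{x. (x0, x) \<in> E ^^ Suc n} = (\<Union>y\<in>{y. (x0, y) \<in> E ^^ n}. {x. (y, x) \<in> E})"
    by auto
  \<comment> \<open>A point outside \<open>V\<close> has no neighbours, so local finiteness extends
    to every \<open>y\<close>.\<close>
  moreover have "finite {x. (y, x) \<in> E}" for y
    using locally_finite[of y] E_subset by (cases "y \<in> V") (auto intro: rev_finite_subset[of "{}"])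
  ultimately show ?case using Suc by simp
qed simp

lemma finite_comb_ball:
  assumes "x0 \<in> V"
  shows "finite (comb_ball V E x0 n)"
proof (rule finite_subset)
  show "comb_ball V E x0 n \<subseteq> (\<Union>k\<le>n. {x. (x0, x) \<in> E ^^ k})"
    using relpow_comb_dist[OF assms] by (auto simp: comb_ball_def)
  show "finite (\<Union>k\<le>n. {x. (x0, x) \<in> E ^^ k})"
    using finite_relpow_sphere[OF assms] by simp
qed

lemma incseq_comb_ball: "incseq (comb_ball V E x0)"
  by (auto simp: incseq_def comb_ball_def)

lemma finite_ball_edges:
  assumes "x0 \<in> V"
  shows "finite (ball_edges V E x0 n)"
  unfolding ball_edges_def using finite_comb_ball[OF assms] by auto

lemma incseq_ball_edges: "incseq (ball_edges V E x0)"
proof (rule monoI)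
  fix m n :: nat assume "m \<le> n"
  then have "comb_ball V E x0 m \<subseteq> comb_ball V E x0 n"
    "comb_ball V E x0 (m + 1) \<subseteq> comb_ball V E x0 (n + 1)"
    "comb_ball V E x0 (m - 1) \<subseteq> comb_ball V E x0 (n - 1)"
    by (auto simp: comb_ball_def)
  then show "ball_edges V E x0 m \<subseteq> ball_edges V E x0 n"
    unfolding ball_edges_def by blast
qed

text \<open>The second endpoint is at most one step farther out, so it lies in the ball of radius
  \<open>n + 1\<close>. Hence the position of \<open>x\<close> alone decides when the bound on
  \<open>deg_E\<close> applies.\<close>

lemma edge_in_ball_edges:
  assumes "x0 \<in> V" "(x, y) \<in> E" "comb_dist E x0 x \<le> n"
  shows "(x, y) \<in> ball_edges V E x0 n"
  using assms comb_dist_edge[OF assms(1,2)] E_subset by (auto simp: ball_edges_def comb_ball_def)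

definition cutoff :: "'v \<Rightarrow> nat \<Rightarrow> 'v \<Rightarrow> real" where
  "cutoff x0 m x = max 0 (min 1 (2 - real (comb_dist E x0 x) / real m))"

lemma cutoff_bounds: "0 \<le> cutoff x0 m x" "cutoff x0 m x \<le> 1"
  by (auto simp: cutoff_def)

lemma cutoff_eq_1: "m \<ge> 1 \<Longrightarrow> comb_dist E x0 x \<le> m \<Longrightarrow> cutoff x0 m x = 1"
  by (auto simp: cutoff_def field_simps)

lemma cutoff_eq_0: "m \<ge> 1 \<Longrightarrow> comb_dist E x0 x \<ge> 2 * m \<Longrightarrow> cutoff x0 m x = 0"
  by (auto simp: cutoff_def max_def min_def field_simps)

text \<open>The distance to \<open>x0\<close> changes by at most 1 across an edge, and clamping to
  the unit interval does not increase differences. For \<open>m = 0\<close> both sides are 0, since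
  division by zero gives 0.\<close>

lemma d0_cutoff_le:
  assumes "x0 \<in> V" "(x, y) \<in> E"
  shows "\<bar>d0 (cutoff x0 m) (x, y)\<bar> \<le> 1 / real m"
proof -
  let ?a = "real (comb_dist E x0 x) / real m" and ?b = "real (comb_dist E x0 y) / real m"
  have "(y, x) \<in> E" using assms(2) sym_E by (auto dest: symD)
  then have "\<bar>real (comb_dist E x0 y) - real (comb_dist E x0 x)\<bar> \<le> 1"
    using comb_dist_edge[OF assms] comb_dist_edge[OF assms(1), of y x] by linarith
  then have "\<bar>?b - ?a\<bar> \<le> 1 / real m"
    by (simp add: divide_right_mono flip: diff_divide_distrib)
  then show ?thesis unfolding d0_def cutoff_def by simp
qed

end

context weighted_magnetic_triangulation
begin

text \<open>The constant 4 is the degree bound \<open>K * (2 * m)^2\<close> at radius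
  \<open>2 * m\<close> times the squared slope \<open>(1 / m)^2\<close>.\<close>

lemma vertex_energy_cutoff_le:
  assumes "x0 \<in> V" "x \<in> V" "m \<ge> 1" "K > 0"
    and K: "\<And>n x. n \<ge> 1 \<Longrightarrow> x \<in> comb_ball V E x0 n \<Longrightarrow> deg_V E c r x \<le> K * real n ^ 2"
  shows "(1 / c x) * (\<Sum>e\<in>{e \<in> E. snd e = x}. r e * \<bar>d0 (cutoff x0 m) e\<bar>\<^sup>2) \<le> 4 * K"
proof -
  let ?N = "{y. (x, y) \<in> E}"
  \<comment> \<open>The energy runs over edges ending at \<open>x\<close>, the degree over edges
    starting there; reversing edges and symmetry of \<open>r\<close> identify the two.\<close>
  have swap: "(\<Sum>e\<in>{e \<in> E. snd e = x}. r e * \<bar>d0 (cutoff x0 m) e\<bar>\<^sup>2)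
      = (\<Sum>y\<in>?N. r (x, y) * \<bar>d0 (cutoff x0 m) (y, x)\<bar>\<^sup>2)"
    using sym_E by (intro sum.reindex_bij_witness[of _ "\<lambda>y. (y, x)" fst])
      (auto simp: r_sym dest: symD)
  show ?thesis
  proof (cases "comb_dist E x0 x \<le> 2 * m")
    case True
    have "(1 / c x) * (\<Sum>y\<in>?N. r (x, y) * \<bar>d0 (cutoff x0 m) (y, x)\<bar>\<^sup>2)
        \<le> (1 / c x) * (\<Sum>y\<in>?N. r (x, y) * (1 / real m)\<^sup>2)"
      using \<open>x0 \<in> V\<close> c_pos[OF \<open>x \<in> V\<close>] r_pos sym_E
      by (intro mult_left_mono sum_mono power_mono d0_cutoff_le)
        (auto dest: symD intro: less_imp_le)
    also have "\<dots> = deg_V E c r x / real m ^ 2"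
      by (simp add: deg_V_def power_divide flip: sum_divide_distrib)
    also have "\<dots> \<le> K * real (2 * m) ^ 2 / real m ^ 2"
      using K[of "2 * m" x] True assms by (intro divide_right_mono) (auto simp: comb_ball_def)
    also have "\<dots> = 4 * K" using \<open>m \<ge> 1\<close> by (simp add: power_mult_distrib)
    finally show ?thesis by (simp only: swap)
  next
    case False
    \<comment> \<open>Here \<open>x\<close> has distance at least \<open>2 * m + 1\<close>, so its
      neighbours still have distance at least \<open>2 * m\<close>, where the cutoff
      vanishes.\<close>
    have "d0 (cutoff x0 m) (y, x) = 0" if "(x, y) \<in> E" for y
      using comb_dist_edge[OF \<open>x0 \<in> V\<close>, of y x] that False sym_E \<open>m \<ge> 1\<close>
      by (auto simp: d0_def cutoff_eq_0 dest: symD)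
    then show ?thesis unfolding swap using \<open>K > 0\<close> by simp
  qed
qed

text \<open>Each summand contains two differences of size at most \<open>1 / m\<close>, so the
  square costs \<open>(2 / m)^2\<close>; with the degree bound \<open>K * (2 * m)^2\<close> this
  gives 16.\<close>

lemma edge_energy_cutoff_le:
  assumes "x0 \<in> V" "(x, y) \<in> E" "m \<ge> 1" "K > 0"
    and K: "\<And>n x y. n \<ge> 1 \<Longrightarrow> (x, y) \<in> ball_edges V E x0 n \<Longrightarrow>
      deg_E V F r s x y \<le> K * real n ^ 2"
  shows "(1 / r (x, y)) * (\<Sum>t\<in>faces_at V F x y.
      s (x, y, t) * \<bar>d0 (cutoff x0 m) (t, x) + d0 (cutoff x0 m) (t, y)\<bar>\<^sup>2) \<le> 16 * K"
proof (cases "comb_dist E x0 x \<le> 2 * m")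
  case True
  have "\<bar>d0 (cutoff x0 m) (t, x) + d0 (cutoff x0 m) (t, y)\<bar> \<le> 2 / real m"
    if "(x, y, t) \<in> F" for t
  proof -
    have "(t, x) \<in> E" "(t, y) \<in> E" using adjacent_F[OF that] sym_E by (auto dest: symD)
    from this[THEN d0_cutoff_le[OF \<open>x0 \<in> V\<close>, of _ _ m]] show ?thesis by linarith
  qed
  then have "(1 / r (x, y)) * (\<Sum>t\<in>faces_at V F x y.
        s (x, y, t) * \<bar>d0 (cutoff x0 m) (t, x) + d0 (cutoff x0 m) (t, y)\<bar>\<^sup>2)
      \<le> (1 / r (x, y)) * (\<Sum>t\<in>faces_at V F x y. s (x, y, t) * (2 / real m)\<^sup>2)"
    using r_pos[OF \<open>(x, y) \<in> E\<close>] s_pos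
    by (intro mult_left_mono sum_mono power_mono) (auto simp: faces_at_def intro: less_imp_le)
  also have "\<dots> = deg_E V F r s x y * (2 / real m)\<^sup>2"
    by (simp only: deg_E_def sum_distrib_right mult.assoc)
  also have "\<dots> \<le> (K * real (2 * m) ^ 2) * (2 / real m)\<^sup>2"
    using K[of "2 * m" x y] edge_in_ball_edges[OF assms(1,2) True] \<open>m \<ge> 1\<close>
    by (intro mult_right_mono) auto
  also have "\<dots> = 16 * K" using \<open>m \<ge> 1\<close> by (simp add: power_mult_distrib power_divide)
  finally show ?thesis .
next
  case False
  \<comment> \<open>Both \<open>y\<close> and every third vertex \<open>t\<close> of a face are
    neighbours of \<open>x\<close>, so vanishing on the neighbours of \<open>x\<close> settles all
    terms.\<close>
  have van: "cutoff x0 m y = 0" if "(x, y) \<in> E" for y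
    using comb_dist_edge[OF \<open>x0 \<in> V\<close>, of y x] that False sym_E \<open>m \<ge> 1\<close>
    by (intro cutoff_eq_0) (auto dest: symD)
  have "d0 (cutoff x0 m) (t, x) + d0 (cutoff x0 m) (t, y) = 0" if "t \<in> faces_at V F x y" for t
  proof -
    have "(x, t) \<in> E"
      using that adjacent_F[of x y t] sym_E by (auto simp: faces_at_def dest: symD)
    then show ?thesis
      using van False \<open>m \<ge> 1\<close> \<open>(x, y) \<in> E\<close> by (simp add: d0_def cutoff_eq_0)
  qed
  then show ?thesis using \<open>K > 0\<close> by simp
qed

end

theorem theorem3:
  fixes V :: "'v set" and E :: "('v \<times> 'v) set" and \<alpha> :: "'v \<times> 'v \<Rightarrow> real"
    and F :: "('v \<times> 'v \<times> 'v) set"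
    and c :: "'v \<Rightarrow> real" and r :: "'v \<times> 'v \<Rightarrow> real" and s :: "'v \<times> 'v \<times> 'v \<Rightarrow> real"
    and x0 :: 'v
  assumes "weighted_magnetic_triangulation V E \<alpha> F c r s"
    and "x0 \<in> V"
    and "(\<lambda>n::nat. SUP x\<in>comb_ball V E x0 n. deg_V E c r x) \<in> O(\<lambda>n. real n ^ 2)"
    and "(\<lambda>n::nat. SUP (x, y)\<in>ball_edges V E x0 n. deg_E V F r s x y) \<in> O(\<lambda>n. real n ^ 2)"
  shows "chi_complete V E F c r s"
proof -
  interpret weighted_magnetic_triangulation V E \<alpha> F c r s by fact
  obtain K1 where K1: "K1 > 0"
    "\<And>n x. n \<ge> 1 \<Longrightarrow> x \<in> comb_ball V E x0 n \<Longrightarrow> deg_V E c r x \<le> K1 * real n ^ 2"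
    using bigo_SUP_imp_bound[OF incseq_comb_ball finite_comb_ball[OF assms(2)] assms(3)]
    by metis
  obtain K2 where K2: "K2 > 0"
    "\<And>n p. n \<ge> 1 \<Longrightarrow> p \<in> ball_edges V E x0 n \<Longrightarrow>
      (case p of (x, y) \<Rightarrow> deg_E V F r s x y) \<le> K2 * real n ^ 2"
    using bigo_SUP_imp_bound[OF incseq_ball_edges finite_ball_edges[OF assms(2)] assms(4)]
    by metis
  have K2': "deg_E V F r s x y \<le> K2 * real n ^ 2"
    if "n \<ge> 1" "(x, y) \<in> ball_edges V E x0 n" for n x y
    using K2(2)[OF that] by simp
  define C where "C = max (4 * K1) (16 * K2)"
  \<comment> \<open>The shift to \<open>Suc n\<close> keeps the slope parameter positive at
    \<open>n = 0\<close>; the cutoff is still 1 on the ball of radius \<open>n\<close>, which is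
    contained in that of radius \<open>Suc n\<close>.\<close>
  define \<chi> where "\<chi> n = cutoff x0 (Suc n)" for n
  have "finite {x \<in> V. \<chi> n x \<noteq> 0}" for n
  proof (rule finite_subset[OF _ finite_comb_ball[OF assms(2)]])
    show "{x \<in> V. \<chi> n x \<noteq> 0} \<subseteq> comb_ball V E x0 (2 * Suc n)"
      using cutoff_eq_0[of "Suc n" x0] by (force simp: \<chi>_def comb_ball_def)
  qed
  moreover have "\<chi> n x = 1" if "x \<in> comb_ball V E x0 n" for n x
    using that by (simp add: \<chi>_def comb_ball_def cutoff_eq_1)
  moreover have "(1 / c x) * (\<Sum>e\<in>{e \<in> E. snd e = x}. r e * \<bar>d0 (\<chi> n) e\<bar>\<^sup>2) \<le> C"
    if "x \<in> V" for n x
    using vertex_energy_cutoff_le[OF assms(2) that _ K1, of "Suc n"]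
    unfolding \<chi>_def C_def by linarith
  moreover have "(1 / r (x, y)) * (\<Sum>t\<in>faces_at V F x y.
      s (x, y, t) * \<bar>d0 (\<chi> n) (t, x) + d0 (\<chi> n) (t, y)\<bar>\<^sup>2) \<le> C" if "(x, y) \<in> E" for n x y
    using edge_energy_cutoff_le[OF assms(2) that _ K2(1) K2', of "Suc n"]
    unfolding \<chi>_def C_def by linarith
  moreover have "V = (\<Union>n. comb_ball V E x0 n)"
    by (auto simp: comb_ball_def)
  moreover have "C > 0" using K1(1) by (simp add: C_def)
  ultimately show ?thesis
    unfolding chi_complete_def
    using incseq_comb_ball[of x0] finite_comb_ball[OF assms(2)] cutoff_bounds
    by (intro exI[of _ C] exI[of _ "comb_ball V E x0"] exI[of _ \<chi>]) (auto simp: \<chi>_def)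
qed

end
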